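(* Let $q$ be a prime power, $n$ a positive integer, and let $\mathcal{U}=\{\vec{u}_1,\ldots,\vec{u}_n\}$, $\mathcal{V}=\{\vec{v}_1,\ldots,\vec{v}_n\}$, $\mathcal{W}=\{\vec{w}_1,\ldots,\vec{w}_n\}$ be three (possibly different) ordered bases of $\mathbb{F}_q^n$ over $\mathbb{F}_q$. Let $\mathcal{I}=\{1,\ldots,n\}$. Let $\{\vec{d}_1,\ldots,\vec{d}_{n-k}\}\subseteq\mathbb{F}_q^n$ be a linearly independent set, chosen such that the numbers $l_s=\bar{\rho}_{\mathcal{W}}(\vec{d}_s)$ satisfy $l_1<\cdots<l_{n-k}$, and let $$C=\{\vec{c}\in\mathbb{F}_q^n\mid\vec{c}\cdot\vec{d}_1=\cdots=\vec{c}\cdot\vec{d}_{n-k}=0\}.$$ Then for $t=1,\ldots,k$ the $t$th generalized Hamming weight of $C$ satisfies $$d_t(C)\ \geq\ \min\Big\{\max\big\{\#\mathcal{I}'\mid\mathcal{I}'\subseteq\mathcal{I},\ \mathcal{I}'\text{ has the }\mu\text{-property with respect to }\{m_1,\ldots,m_t\}\big\}\ \Big|\ m_1<\cdots<m_t,\ m_s\in\mathcal{I}\setminus\{l_1,\ldots,l_{n-k}\}\text{ for }s=1,\ldots,t\Big\}.$$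
   Context: Notation. For $\vec{u},\vec{v}\in\mathbb{F}_q^n$, $\vec{u}\ast\vec{v}=(u_1v_1,\ldots,u_nv_n)$ is the componentwise product and $\vec{u}\cdot\vec{v}=\sum_i u_iv_i$ the usual inner product. The support of a subspace $D$ is $\mathrm{Supp}\,D=\{i\mid c_i\neq 0 \text{ for some } \vec{c}\in D\}$. For a linear code $C\subseteq\mathbb{F}_q^n$ of dimension $k$ and $1\le t\le k$, the $t$th generalized Hamming weight is $d_t(C)=\min\{\#\mathrm{Supp}\,D\mid D\text{ is a subspace of }C\text{ of dimension }t\}$. The function $\bar{\rho}_{\mathcal{W}}:\mathbb{F}_q^n\to\{0,1,\ldots,n\}$ is given by $\bar{\rho}_{\mathcal{W}}(\vec{0})=0$ and, for $\vec{c}\neq\vec{0}$, $\bar{\rho}_{\mathcal{W}}(\vec{c})=i$ if $\vec{c}\in\mathrm{Span}\{\vec{w}_1,\ldots,\vec{w}_i\}\setminus\mathrm{Span}\{\vec{w}_1,\ldots,\vec{w}_{i-1}\}$ (with $\mathrm{Span}\,\emptyset=\{\vec{0}\}$). For $\mathcal{I}'\subseteq\mathcal{I}$, a pair $(i,j)\in\mathcal{I}'\times\mathcal{I}$ is one-way well-behaving (OWB) with respect to $\mathcal{I}'$ if $\bar{\rho}_{\mathcal{W}}(\vec{u}_{i'}\ast\vec{v}_j)<\bar{\rho}_{\mathcal{W}}(\vec{u}_i\ast\vec{v}_j)$ for all $i'\in\mathcal{I}'$ with $i'<i$. The set $\mathcal{I}'\subseteq\mathcal{I}$ has the $\mu$-property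 with respect to a set $\{m_1,\ldots,m_t\}\subseteq\mathcal{I}$ if for all $i\in\mathcal{I}'$ there exists $j\in\mathcal{I}$ such that $(i,j)$ is OWB with respect to $\mathcal{I}'$ and $\bar{\rho}_{\mathcal{W}}(\vec{u}_i\ast\vec{v}_j)\in\{m_1,\ldots,m_t\}$. *)

theory Defs
  imports "HOL-Analysis.Analysis"
begin

text \<open>
  The ambient space \<open>\<F>\<^sub>q\<^sup>n\<close> is \<open>'a ^ 'n\<close> for a finite field \<open>'a\<close>, so \<open>q = CARD('a)\<close> and
  \<open>n = CARD('n)\<close>. The product \<open>u * v\<close> of this type is the componentwise one. An indexed family of
  vectors is a function on \<open>nat\<close> of which only the values at \<open>1, \<dots>, n\<close> matter.
\<close>

definition ordered_basis :: "(nat \<Rightarrow> 'a::field ^ 'n) \<Rightarrow> bool" where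
  "ordered_basis b \<longleftrightarrow>
     inj_on b {1..CARD('n)} \<and>
     vec.independent (b ` {1..CARD('n)}) \<and>
     vec.span (b ` {1..CARD('n)}) = UNIV"

text \<open>The library's \<open>inner\<close> is only available over the reals.\<close>

definition dot_prod :: "'a::field ^ 'n \<Rightarrow> 'a ^ 'n \<Rightarrow> 'a" where
  "dot_prod u v = (\<Sum>i\<in>UNIV. u $ i * v $ i)"

definition Supp :: "('a::field ^ 'n) set \<Rightarrow> 'n set" where
  "Supp D = {i. \<exists>c\<in>D. c $ i \<noteq> 0}"

definition gen_hamming_weight :: "nat \<Rightarrow> ('a::{field, finite} ^ 'n) set \<Rightarrow> nat" where
  "gen_hamming_weight t C = Min {card (Supp D) | D. vec.subspace D \<and> D \<subseteq> C \<and> vec.dim D = t}"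

definition rho_bar :: "(nat \<Rightarrow> 'a::field ^ 'n) \<Rightarrow> 'a ^ 'n \<Rightarrow> nat" where
  "rho_bar w c =
     (if c = 0 then 0
      else (THE i. i \<in> {1..CARD('n)} \<and> c \<in> vec.span (w ` {1..i}) - vec.span (w ` {1..<i})))"

definition owb ::
  "(nat \<Rightarrow> 'a::field ^ 'n) \<Rightarrow> (nat \<Rightarrow> 'a ^ 'n) \<Rightarrow> (nat \<Rightarrow> 'a ^ 'n) \<Rightarrow> nat set \<Rightarrow> nat \<Rightarrow> nat \<Rightarrow> bool"
  where
  "owb u v w I' i j \<longleftrightarrow>
     i \<in> I' \<and> j \<in> {1..CARD('n)} \<and>
     (\<forall>i'\<in>I'. i' < i \<longrightarrow> rho_bar w (u i' * v j) < rho_bar w (u i * v j))"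

definition mu_property ::
  "(nat \<Rightarrow> 'a::field ^ 'n) \<Rightarrow> (nat \<Rightarrow> 'a ^ 'n) \<Rightarrow> (nat \<Rightarrow> 'a ^ 'n) \<Rightarrow> nat set \<Rightarrow> nat set \<Rightarrow> bool"
  where
  "mu_property u v w I' M \<longleftrightarrow>
     (\<forall>i\<in>I'. \<exists>j\<in>{1..CARD('n)}. owb u v w I' i j \<and> rho_bar w (u i * v j) \<in> M)"

end

theory Submission
  imports Defs
begin

text \<open>
  Let \<open>D \<subseteq> C\<close> have dimension \<open>t\<close>. Each \<open>d\<^sub>s\<close> lies in \<open>D\<^sup>\<bottom>\<close>, and a space of dimension \<open>r\<close> attains at
  most \<open>r\<close> nonzero values of \<open>rho_bar\<close>. As \<open>D\<^sup>\<bottom>\<close> has dimension \<open>n - t\<close>, there are \<open>m\<^sub>1 < \<dots> < m\<^sub>t\<close> in \<open>{1..n}\<close>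
  which \<open>rho_bar\<close> does not attain on \<open>D\<^sup>\<bottom>\<close>; in particular they avoid the numbers \<open>l\<^sub>s\<close>. Let \<open>I'\<close> have the
  \<open>\<mu>\<close>-property for these numbers, and let \<open>z \<noteq> 0\<close> be a combination of the \<open>u\<^sub>i\<close>, \<open>i \<in> I'\<close>, with leading
  index \<open>i\<close>. For the \<open>j\<close> belonging to \<open>i\<close>, the product \<open>z * v\<^sub>j\<close> has the same \<open>rho_bar\<close> as \<open>u\<^sub>i * v\<^sub>j\<close>,
  namely some \<open>m\<^sub>s\<close>, so \<open>z * v\<^sub>j\<close> is not in \<open>D\<^sup>\<bottom>\<close> and \<open>z\<close> cannot vanish on \<open>Supp D\<close>. Hence the
  restrictions of the \<open>u\<^sub>i\<close> to \<open>Supp D\<close> are linearly independent, and \<open>card I' \<le> card (Supp D)\<close>.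
\<close>

section \<open>Orthogonal complements and dimension counts\<close>

definition orth :: "('a::field ^ 'n) set \<Rightarrow> ('a ^ 'n) set" where
  "orth S = {y. \<forall>x\<in>S. dot_prod y x = 0}"

lemma dot_prod_add_left: "dot_prod (x + y) z = dot_prod x z + dot_prod y z"
  by (simp add: dot_prod_def algebra_simps sum.distrib)

lemma dot_prod_scale_left: "dot_prod (a *s x) z = a * dot_prod x z"
  by (simp add: dot_prod_def algebra_simps sum_distrib_left)

lemma dot_prod_commute: "dot_prod x y = dot_prod y x"
  by (simp add: dot_prod_def mult.commute)

lemma dot_prod_axis: "dot_prod x (axis l 1) = x $ l"
  by (simp add: dot_prod_def axis_def if_distrib cong: if_cong)

lemma subspace_orth: "vec.subspace (orth S)"
  by (auto simp: vec.subspace_def orth_def dot_prod_add_left dot_prod_scale_left)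
     (simp add: dot_prod_def)

lemma orth_antimono: "S \<subseteq> T \<Longrightarrow> orth T \<subseteq> orth S"
  by (auto simp: orth_def)

lemma orth_span: "orth (vec.span S) = orth S"
proof
  show "orth S \<subseteq> orth (vec.span S)"
  proof
    fix y assume "y \<in> orth S"
    then have "S \<subseteq> orth {y}" by (auto simp: orth_def dot_prod_commute)
    then have "vec.span S \<subseteq> orth {y}" by (simp add: subspace_orth vec.span_minimal)
    then show "y \<in> orth (vec.span S)" by (auto simp: orth_def dot_prod_commute)
  qed
qed (simp add: orth_antimono vec.span_superset)

lemma orth_UNIV: "orth UNIV = {0}"
proof -
  have "y = 0" if "y \<in> orth UNIV" for y :: "'a ^ 'b"
    using that by (metis (mono_tags, lifting) UNIV_I dot_prod_axis mem_Collect_eq orth_def vec_eq_iff zero_index)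
  then show ?thesis using vec.subspace_0[OF subspace_orth] by blast
qed

text \<open>One linear condition costs at most one dimension: if some \<open>e\<close> in
  \<open>U\<close> violates it, a suitable multiple of \<open>e\<close> corrects every other element
  of \<open>U\<close>.\<close>

lemma dim_le_Suc_dim_orth:
  assumes "vec.subspace U"
  shows "vec.dim U \<le> Suc (vec.dim (U \<inter> orth {x}))"
proof (cases "U \<subseteq> orth {x}")
  case True
  then show ?thesis by (simp add: Int_absorb2)
next
  case False
  then obtain e where e: "e \<in> U" "dot_prod e x \<noteq> 0" by (auto simp: orth_def)
  have "U \<subseteq> vec.span (insert e (U \<inter> orth {x}))"
  proof
    fix y assume y: "y \<in> U"
    define b where "b = - (dot_prod y x / dot_prod e x)"
    have "y + b *s e \<in> U"
      using assms y e(1) by (intro vec.subspace_add vec.subspace_scale)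
    moreover have "dot_prod (y + b *s e) x = 0"
      using e(2) by (simp only: dot_prod_add_left dot_prod_scale_left) (simp add: b_def)
    ultimately have "y + b *s e \<in> U \<inter> orth {x}" by (simp add: orth_def)
    then have "(y + b *s e) - b *s e \<in> vec.span (insert e (U \<inter> orth {x}))"
      by (intro vec.span_diff vec.span_scale) (auto intro: vec.span_base)
    then show "y \<in> vec.span (insert e (U \<inter> orth {x}))" by simp
  qed
  then have "vec.dim U \<le> vec.dim (insert e (U \<inter> orth {x}))" by (rule vec.dim_mono)
  then show ?thesis by (simp add: vec.dim_insert split: if_splits)
qed

lemma dim_le_dim_orth_add_card:
  assumes "finite S" "vec.subspace U"
  shows "vec.dim U \<le> vec.dim (U \<inter> orth S) + card S"
  using assms(1)
proof induction
  case empty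
  then show ?case by (simp add: orth_def)
next
  case (insert x S)
  have "vec.dim (U \<inter> orth S) \<le> Suc (vec.dim ((U \<inter> orth S) \<inter> orth {x}))"
    by (intro dim_le_Suc_dim_orth vec.subspace_inter assms subspace_orth)
  moreover have "(U \<inter> orth S) \<inter> orth {x} = U \<inter> orth (insert x S)" by (auto simp: orth_def)
  ultimately show ?case using insert by simp
qed

text \<open>Extend a basis \<open>B\<close> of \<open>D\<close> to a basis \<open>B'\<close> of the
  whole space. The \<open>card (B' - B)\<close> further conditions cut \<open>orth B\<close> down to
  \<open>orth B' = {0}\<close>, which bounds its dimension.\<close>

lemma dim_orth_add_dim_le: "vec.dim (orth D) + vec.dim D \<le> CARD('n)"
  for D :: "('a::field ^ 'n) set"
proof -
  obtain B where B: "B \<subseteq> D" "vec.independent B" "D \<subseteq> vec.span B" "card B = vec.dim D"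
    using vec.basis_exists by blast
  obtain B' where B': "B \<subseteq> B'" "vec.independent B'" "UNIV \<subseteq> vec.span B'"
    by (rule vec.maximal_independent_subset_extend[OF subset_UNIV B(2)])
  have fin: "finite B'" using B'(2) by (rule vec.finiteI_independent)
  have "card B' = CARD('n)"
    using vec.basis_card_eq_dim[of B' UNIV] B' by (simp add: vec.dim_UNIV card_cart_basis)
  moreover have "card B' = card B + card (B' - B)"
    by (metis B'(1) add.commute card_Diff_subset card_mono fin finite_subset le_add_diff_inverse2)
  moreover have "vec.dim (orth B) \<le> vec.dim (orth B \<inter> orth (B' - B)) + card (B' - B)"
    by (rule dim_le_dim_orth_add_card) (auto simp: fin subspace_orth)
  moreover have "orth B \<inter> orth (B' - B) = orth B'" using B'(1) by (auto simp: orth_def)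
  moreover have "orth B' = {0}"
    by (metis B'(3) orth_UNIV orth_span top.extremum_unique)
  moreover have "vec.dim (orth D) \<le> vec.dim (orth B)"
    by (intro vec.dim_subset orth_antimono B)
  ultimately show ?thesis using B(4) by simp
qed

section \<open>The function \<open>rho_bar\<close> and linear independence\<close>

lemma rho_bar_props:
  fixes w :: "nat \<Rightarrow> 'a::field ^ 'n"
  assumes "ordered_basis w" and "c \<noteq> 0"
  shows "rho_bar w c \<in> {1..CARD('n)}"
    and "c \<in> vec.span (w ` {1..rho_bar w c})" and "c \<notin> vec.span (w ` {1..<rho_bar w c})"
proof -
  define Q where "Q i \<longleftrightarrow> c \<in> vec.span (w ` {1..i})" for i
  define i where "i = (LEAST i. Q i)"
  have "Q CARD('n)" using assms(1) by (simp add: Q_def ordered_basis_def)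
  then have i: "Q i" "i \<le> CARD('n)" unfolding i_def by (auto intro: LeastI Least_le)
  have mono: "Q b" if "Q a" "a \<le> b" for a b
  proof -
    have "vec.span (w ` {1..a}) \<subseteq> vec.span (w ` {1..b})"
      using that(2) by (intro vec.span_mono image_mono) auto
    then show ?thesis using that(1) by (auto simp only: Q_def)
  qed
  \<comment> \<open>The spans increase, so membership of \<open>c\<close> is a threshold condition;
    this makes the index described by \<open>THE\<close> unique.\<close>
  have Q_iff: "Q a \<longleftrightarrow> i \<le> a" for a
    using mono[OF i(1)] Least_le[of Q a] unfolding i_def by blast
  have "\<not> Q 0" using assms(2) by (simp add: Q_def)
  then have i0: "i > 0" using i(1) by (cases i) auto
  have lt: "c \<in> vec.span (w ` {1..<a}) \<longleftrightarrow> i < a" if "a \<ge> 1" for a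
  proof -
    have "{1..<a} = {1..a - 1}" using that by auto
    then have "c \<in> vec.span (w ` {1..<a}) \<longleftrightarrow> Q (a - 1)" by (simp only: Q_def)
    then show ?thesis using that by (simp add: Q_iff less_eq_Suc_le) arith
  qed
  have iff: "a \<in> {1..CARD('n)} \<and> c \<in> vec.span (w ` {1..a}) - vec.span (w ` {1..<a}) \<longleftrightarrow> a = i" for a
    using Q_iff[of a] lt[of a] i(2) i0 unfolding Q_def Diff_iff atLeastAtMost_iff by linarith
  then have "rho_bar w c = i" using assms(2) unfolding rho_bar_def iff by simp
  with iff[of i] show "rho_bar w c \<in> {1..CARD('n)}"
    and "c \<in> vec.span (w ` {1..rho_bar w c})" and "c \<notin> vec.span (w ` {1..<rho_bar w c})" by simp_all
qed

lemma rho_bar_eqI: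
  fixes w :: "nat \<Rightarrow> 'a::field ^ 'n"
  assumes w: "ordered_basis w"
    and c: "c \<in> vec.span (w ` {1..i})" "c \<notin> vec.span (w ` {1..<i})"
  shows "rho_bar w c = i"
proof -
  have "c \<noteq> 0" using c(2) vec.span_zero by blast
  note r = rho_bar_props[OF w this]
  have "\<not> rho_bar w c < i"
  proof
    assume "rho_bar w c < i"
    then have "vec.span (w ` {1..rho_bar w c}) \<subseteq> vec.span (w ` {1..<i})"
      by (intro vec.span_mono) auto
    then show False using r c by blast
  qed
  moreover have "\<not> i < rho_bar w c"
  proof
    assume "i < rho_bar w c"
    then have "vec.span (w ` {1..i}) \<subseteq> vec.span (w ` {1..<rho_bar w c})"
      by (intro vec.span_mono) auto
    then show False using r c by blast
  qed
  ultimately show ?thesis by simp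
qed

lemma in_span_less_rho_bar:
  assumes "ordered_basis w" and "rho_bar w c < i"
  shows "c \<in> vec.span (w ` {1..<i})"
proof (cases "c = 0")
  case False
  have "vec.span (w ` {1..rho_bar w c}) \<subseteq> vec.span (w ` {1..<i})"
    by (intro vec.span_mono) (use assms(2) in auto)
  then show ?thesis using rho_bar_props(2)[OF assms(1) False] by blast
qed (simp add: vec.span_zero)

text \<open>All terms but the one at \<open>e\<close> lie in the span of the basis vectors before
  the index \<open>rho_bar w (x e)\<close>. If the sum did too, subtracting them and dividing by
  \<open>a e\<close> would put \<open>x e\<close> there.\<close>

lemma rho_bar_sum_dominant:
  assumes w: "ordered_basis w" and fin: "finite K" and e: "e \<in> K" "a e \<noteq> 0" "x e \<noteq> 0"
    and less: "\<And>i. i \<in> K \<Longrightarrow> i \<noteq> e \<Longrightarrow> a i \<noteq> 0 \<Longrightarrow> rho_bar w (x i) < rho_bar w (x e)"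
  shows "rho_bar w (\<Sum>i\<in>K. a i *s x i) = rho_bar w (x e)"
proof (rule rho_bar_eqI[OF w])
  let ?r = "rho_bar w (x e)"
  note r = rho_bar_props[OF w e(3)]
  define y where "y = (\<Sum>i\<in>K - {e}. a i *s x i)"
  have sum: "(\<Sum>i\<in>K. a i *s x i) = a e *s x e + y"
    using fin e(1) by (simp add: y_def sum.remove)
  have y: "y \<in> vec.span (w ` {1..<?r})"
    unfolding y_def
  proof (rule vec.span_sum)
    fix i assume "i \<in> K - {e}"
    then show "a i *s x i \<in> vec.span (w ` {1..<?r})"
      using less[of i] in_span_less_rho_bar[OF w, of "x i" ?r]
      by (cases "a i = 0") (auto simp: vec.span_zero intro: vec.span_scale)
  qed
  moreover have "vec.span (w ` {1..<?r}) \<subseteq> vec.span (w ` {1..?r})"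
    by (intro vec.span_mono) auto
  ultimately show "(\<Sum>i\<in>K. a i *s x i) \<in> vec.span (w ` {1..?r})"
    unfolding sum using r(2) by (intro vec.span_add vec.span_scale) auto
  show "(\<Sum>i\<in>K. a i *s x i) \<notin> vec.span (w ` {1..<?r})"
  proof
    assume "(\<Sum>i\<in>K. a i *s x i) \<in> vec.span (w ` {1..<?r})"
    then have "(a e *s x e + y) - y \<in> vec.span (w ` {1..<?r})"
      unfolding sum using y by (rule vec.span_diff)
    then have "a e *s x e \<in> vec.span (w ` {1..<?r})" by simp
    then have "inverse (a e) *s (a e *s x e) \<in> vec.span (w ` {1..<?r})" by (rule vec.span_scale)
    then show False using e(2) r(3) by (simp add: vector_smult_assoc)
  qed
qed

text \<open>Distinct values of \<open>rho_bar\<close> let one term dominate any nontrivial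
  combination, whose \<open>rho_bar\<close> is then positive, unlike that of 0.\<close>

lemma independent_if_inj_on_rho_bar:
  fixes B :: "('a::field ^ 'n) set"
  assumes w: "ordered_basis w" and fin: "finite B" and nz: "0 \<notin> B" and inj: "inj_on (rho_bar w) B"
  shows "vec.independent B"
proof (rule vec.independent_if_scalars_zero[OF fin], rule ccontr)
  fix f x assume sum: "(\<Sum>x\<in>B. f x *s x) = 0" and x: "x \<in> B" "f x \<noteq> 0"
  define N where "N = {y \<in> B. f y \<noteq> 0}"
  have N: "finite N" "N \<noteq> {}" using fin x by (auto simp: N_def)
  then have "Max (rho_bar w ` N) \<in> rho_bar w ` N" by simp
  then obtain e where "e \<in> N" "rho_bar w e = Max (rho_bar w ` N)" by auto
  then have e: "e \<in> N" "\<And>y. y \<in> N \<Longrightarrow> rho_bar w y \<le> rho_bar w e" using N by simp_all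
  have "rho_bar w (\<Sum>x\<in>B. f x *s x) = rho_bar w e"
  proof (rule rho_bar_sum_dominant[OF w fin])
    fix i assume "i \<in> B" "i \<noteq> e" "f i \<noteq> 0"
    then show "rho_bar w i < rho_bar w e"
      using e inj by (auto simp: N_def inj_on_def intro: le_neq_implies_less)
  qed (use e nz in \<open>auto simp: N_def\<close>)
  moreover have "rho_bar w e \<noteq> 0"
    using rho_bar_props(1)[OF w, of e] e(1) nz by (cases "e = 0") (auto simp: N_def)
  ultimately show False unfolding sum by (simp add: rho_bar_def)
qed

lemma card_rho_bar_image_le_dim:
  fixes A :: "('a::field ^ 'n) set"
  assumes w: "ordered_basis w"
  shows "card (rho_bar w ` (A - {0})) \<le> vec.dim A"
proof -
  obtain B where B: "B \<subseteq> A - {0}" "inj_on (rho_bar w) B" "rho_bar w ` B = rho_bar w ` (A - {0})"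
    by (metis subset_image_inj order_refl)
  have "rho_bar w ` B \<subseteq> {1..CARD('n)}" using B(1) rho_bar_props(1)[OF w] by blast
  then have "finite B" using B(2) by (meson finite_atLeastAtMost finite_imageD finite_subset)
  then have "vec.independent B" using independent_if_inj_on_rho_bar[OF w] B by blast
  then have "card B \<le> vec.dim A" using B(1) by (intro vec.independent_card_le_dim) auto
  then show ?thesis using B by (metis card_image)
qed

section \<open>From the \<mu>-property to the size of the support\<close>

lemma mult_in_orth_if_vanishes_on_Supp:
  assumes "\<And>l. l \<in> Supp D \<Longrightarrow> z $ l = 0"
  shows "z * y \<in> orth D"
proof -
  have "(z * y) $ l * c $ l = 0" if "c \<in> D" for c l
    using assms[of l] that by (cases "c $ l = 0") (auto simp: Supp_def)
  then show ?thesis unfolding orth_def dot_prod_def by (auto intro: sum.neutral)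
qed

lemma card_le_card_Supp:
  fixes u v w :: "nat \<Rightarrow> 'a::field ^ 'n"
  assumes u: "ordered_basis u" and w: "ordered_basis w"
    and I: "I' \<subseteq> {1..CARD('n)}" and mu: "mu_property u v w I' M"
    and M: "M \<subseteq> {1..CARD('n)} - rho_bar w ` orth D"
  shows "card I' \<le> card (Supp D)"
proof -
  \<comment> \<open>Orthogonality to the unit vectors in \<open>?S\<close> means vanishing on
    \<open>Supp D\<close>. Restriction to \<open>Supp D\<close> is thus injective on
    \<open>?W\<close> exactly when \<open>?W\<close> meets \<open>orth ?S\<close> trivially.\<close>
  let ?W = "vec.span (u ` I')" and ?S = "(\<lambda>l. axis l 1) ` Supp D :: ('a ^ 'n) set"
  have finI: "finite I'" using I finite_subset by blast
  have inj: "inj_on u I'"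
    using u I unfolding ordered_basis_def by (blast intro: inj_on_subset)
  have ind: "vec.independent (u ` I')"
    using u vec.independent_mono[OF _ image_mono[OF I]] unfolding ordered_basis_def by blast
  have "z = 0" if "z \<in> ?W \<inter> orth ?S" for z
  proof (rule ccontr)
    assume nz: "z \<noteq> 0"
    have van: "z $ l = 0" if "l \<in> Supp D" for l
      using \<open>z \<in> ?W \<inter> orth ?S\<close> that by (auto simp: orth_def dot_prod_axis)
    obtain b where "z = (\<Sum>x\<in>u ` I'. b x *s x)"
      using \<open>z \<in> ?W \<inter> orth ?S\<close> finI by (auto simp: vec.span_finite)
    then have z: "z = (\<Sum>i\<in>I'. b (u i) *s u i)" using inj by (simp add: sum.reindex)
    define N where "N = {i \<in> I'. b (u i) \<noteq> 0}"
    have "N \<noteq> {}"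
    proof
      assume "N = {}"
      then have "z = 0" unfolding z N_def by (intro sum.neutral) auto
      with nz show False by simp
    qed
    moreover have "finite N" using finI by (simp add: N_def)
    ultimately have e: "Max N \<in> N" "\<And>i. i \<in> N \<Longrightarrow> i \<le> Max N" by auto
    then obtain j where j: "owb u v w I' (Max N) j" "rho_bar w (u (Max N) * v j) \<in> M"
      using mu by (auto simp: mu_property_def N_def)
    have "z * v j = (\<Sum>i\<in>I'. b (u i) *s (u i * v j))"
      unfolding z by (simp add: vec_eq_iff sum_distrib_right mult.assoc)
    also have "rho_bar w \<dots> = rho_bar w (u (Max N) * v j)"
    proof (rule rho_bar_sum_dominant[OF w finI])
      \<comment> \<open>The zero vector has \<open>rho_bar\<close> equal to 0, which is not in
        \<open>M\<close>.\<close>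
      show "u (Max N) * v j \<noteq> 0" using j(2) M by (auto simp: rho_bar_def)
    next
      \<comment> \<open>Every other index with a nonzero coefficient is below \<open>Max N\<close>,
        where the OWB condition gives the strict inequality.\<close>
      fix i assume "i \<in> I'" "i \<noteq> Max N" "b (u i) \<noteq> 0"
      then show "rho_bar w (u i * v j) < rho_bar w (u (Max N) * v j)"
        using j(1) e(2)[of i] by (auto simp: owb_def N_def)
    qed (use e(1) in \<open>auto simp: N_def\<close>)
    finally have "rho_bar w (z * v j) \<in> M" using j(2) by simp
    moreover have "z * v j \<in> orth D" using van by (rule mult_in_orth_if_vanishes_on_Supp)
    ultimately show False using M by blast
  qed
  then have "?W \<inter> orth ?S \<subseteq> {0}" by blast
  then have "vec.dim (?W \<inter> orth ?S) = 0" by simp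
  moreover have "vec.dim ?W \<le> vec.dim (?W \<inter> orth ?S) + card ?S"
    by (rule dim_le_dim_orth_add_card) auto
  moreover have "card ?S \<le> card (Supp D)" by (simp add: card_image_le)
  moreover have "vec.dim ?W = card I'"
    using vec.dim_span_eq_card_independent[OF ind] card_image[OF inj] by (rule trans)
  ultimately show ?thesis by linarith
qed

section \<open>Choosing the numbers and a minimal subspace\<close>

lemma strict_mono_enumeration_atLeastAtMost:
  fixes M :: "nat set"
  assumes "finite M"
  obtains m :: "nat \<Rightarrow> nat" where "strict_mono_on {1..card M} m" and "m ` {1..card M} = M"
proof -
  obtain h where h: "bij_betw h {..<card M} M" "strict_mono_on {..<card M} h"
    using ex_bij_betw_strict_mono_card[OF assms] by blast
  have "strict_mono_on {1..card M} (\<lambda>s. h (s - 1))"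
    using h(2) by (auto intro!: strict_mono_onI strict_mono_onD[OF h(2)])
  moreover have "(\<lambda>s. h (s - 1)) ` {1..card M} = h ` {..<card M}"
    unfolding image_Suc_lessThan[symmetric] image_image by simp
  ultimately show thesis using h(1) that by (simp add: bij_betw_def)
qed

text \<open>The span of \<open>t\<close> vectors from a basis of \<open>C\<close> shows that the
  minimum is taken over a nonempty set, so it is a genuine value.\<close>

lemma gen_hamming_weight_attained:
  fixes C :: "('a::{field, finite} ^ 'n) set"
  assumes "vec.subspace C" and "t \<le> vec.dim C"
  obtains D where "vec.subspace D" and "D \<subseteq> C" and "vec.dim D = t"
    and "gen_hamming_weight t C = card (Supp D)"
proof -
  let ?X = "{card (Supp D) | D. vec.subspace D \<and> D \<subseteq> C \<and> vec.dim D = t}"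
  obtain B where B: "B \<subseteq> C" "vec.independent B" "card B = vec.dim C"
    by (rule vec.basis_exists[of C])
  obtain B' where B': "B' \<subseteq> B" "card B' = t"
    using obtain_subset_with_card_n[of t B] assms(2) B(3) by auto
  have "vec.dim (vec.span B') = t"
    using B B' by (metis vec.dim_span_eq_card_independent vec.independent_mono)
  moreover have "vec.span B' \<subseteq> C" using B B' assms(1) by (intro vec.span_minimal) auto
  ultimately have "?X \<noteq> {}" by (auto intro: exI[of _ "vec.span B'"])
  moreover have "finite ?X" by (rule finite_subset[of _ "{..CARD('n)}"]) (auto intro: card_mono)
  ultimately have "Min ?X \<in> ?X" by (rule Min_in[rotated])
  then show thesis using that unfolding gen_hamming_weight_def by auto
qed

theorem theorem16:
  fixes u v w d :: "nat \<Rightarrow> 'a::{field, finite} ^ 'n"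
    and k t :: nat
    and C :: "('a ^ 'n) set"
  defines "C \<equiv> {c. \<forall>s\<in>{1..CARD('n) - k}. dot_prod c (d s) = 0}"
  assumes "ordered_basis u" and "ordered_basis v" and "ordered_basis w"
    and "k \<le> CARD('n)"
    and "vec.independent (d ` {1..CARD('n) - k})"
    and "strict_mono_on {1..CARD('n) - k} (\<lambda>s. rho_bar w (d s))"
    and "t \<in> {1..k}"
  shows "gen_hamming_weight t C \<ge>
    Min {Max {card I' | I'. I' \<subseteq> {1..CARD('n)} \<and> mu_property u v w I' (m ` {1..t})} | m.
           strict_mono_on {1..t} m \<and>
           (\<forall>s\<in>{1..t}. m s \<in> {1..CARD('n)} - (\<lambda>s. rho_bar w (d s)) ` {1..CARD('n) - k})}"
proof -
  let ?n = "CARD('n)"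
  let ?ds = "d ` {1..?n - k}"
  let ?F = "\<lambda>M. {card I' | I'. I' \<subseteq> {1..?n} \<and> mu_property u v w I' M}"
  let ?P = "\<lambda>m. strict_mono_on {1..t} m \<and>
    (\<forall>s\<in>{1..t}. m s \<in> {1..?n} - (\<lambda>s. rho_bar w (d s)) ` {1..?n - k})"
  have C: "C = orth ?ds" by (auto simp: C_def orth_def)
  have "?n \<le> vec.dim C + card ?ds"
    using dim_le_dim_orth_add_card[of ?ds UNIV] by (simp add: C card_cart_basis)
  moreover have "card ?ds \<le> ?n - k" using card_image_le[of "{1..?n - k}" d] by simp
  ultimately have "?n \<le> vec.dim C + (?n - k)" by linarith
  moreover have "t \<le> k" using assms(8) by simp
  ultimately have "t \<le> vec.dim C" using assms(5) by linarith
  then obtain D where D: "D \<subseteq> C" "vec.dim D = t" "gen_hamming_weight t C = card (Supp D)"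
    using gen_hamming_weight_attained subspace_orth C by metis
  have ds: "?ds \<subseteq> orth D" using D(1) by (auto simp: C orth_def dot_prod_commute)
  \<comment> \<open>Leaving out 0 matches the dimension bound on attained values:
    \<open>orth D\<close> has dimension at most \<open>n - t\<close>, so at least \<open>t\<close>
    indices remain.\<close>
  define J where "J = {1..?n} - rho_bar w ` (orth D - {0})"
  have "card J \<ge> ?n - card (rho_bar w ` (orth D - {0}))"
    unfolding J_def using diff_card_le_card_Diff[of "rho_bar w ` (orth D - {0})" "{1..?n}"]
    by (simp add: finite_subset[of _ "{1..?n}"])
  then have "t \<le> card J"
    using card_rho_bar_image_le_dim[OF assms(4), of "orth D"] dim_orth_add_dim_le[of D] D(2) by simp
  then obtain M where M: "M \<subseteq> J" "card M = t" "finite M"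
    by (metis obtain_subset_with_card_n)
  obtain m where m: "strict_mono_on {1..t} m" "m ` {1..t} = M"
    using strict_mono_enumeration_atLeastAtMost M by metis
  \<comment> \<open>Putting 0 back is harmless, since its value 0 is outside
    \<open>{1..n}\<close>.\<close>
  have M_sub: "M \<subseteq> {1..?n} - rho_bar w ` orth D"
    using M(1) by (auto simp: J_def rho_bar_def)
  then have P: "?P m" using m ds by fastforce
  have fin: "finite (?F M')" for M'
    by (rule finite_subset[of _ "card ` Pow {1..?n}"]) auto
  \<comment> \<open>The empty set has the \<mu>-property vacuously, so the maximum is
    attained.\<close>
  have "0 \<in> ?F M" by (auto simp: mu_property_def intro!: exI[of _ "{}"])
  then have "Max (?F M) \<in> ?F M" using Max_in fin by blast
  then have le: "Max (?F M) \<le> card (Supp D)"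
    using card_le_card_Supp[OF assms(2,4) _ _ M_sub] by auto
  \<comment> \<open>Infinitely many functions \<open>m\<close> may agree on \<open>{1..t}\<close>,
    but the maximum depends only on the image, one of finitely many subsets of
    \<open>{1..n}\<close>.\<close>
  have "{Max (?F (m ` {1..t})) | m. ?P m} \<subseteq> (\<lambda>M. Max (?F M)) ` Pow {1..?n}"
    by blast
  then have "finite {Max (?F (m ` {1..t})) | m. ?P m}" by (rule finite_subset) simp
  then have "Min {Max (?F (m ` {1..t})) | m. ?P m} \<le> Max (?F (m ` {1..t}))"
    using P by (intro Min_le) blast+
  then show ?thesis using le D(3) m(2) by simp
qed

end
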